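(* Let $\alpha=(\alpha_1,\ldots,\alpha_n)\in \mathrm{int}\,\Delta_{n-1}$. Let $m\le n$, $M=\{1,\ldots,m\}$, and consider $m$ linearly independent vectors $u^1,\ldots,u^m\in\mathbb{R}^n$, where for each $i\in M$ the vector $u^i=(u_{i1},u_{i2},\ldots,u_{in})$ is an efficient value vector (EVV) associated to $\beta^i=(\beta_{i1},\ldots,\beta_{in})\in\Delta_{n-1}$. Let $U=(u^1,u^2,\ldots,u^m)$ be the $n\times m$ matrix whose $i$-th column is $u^i$, and let $\bar U$ be an $m\times m$ submatrix of $U$ (obtained by selecting $m$ of its rows) such that $\det(\bar U)\neq 0$. Let $\bar\alpha=(\bar\alpha_1,\ldots,\bar\alpha_m)\in\mathbb{R}^m$ be obtained from $\alpha$ by selecting the elements corresponding to the rows in $\bar U$, and for $i\in M$ let $\bar U_{\alpha i}$ be the $m\times m$ matrix obtained by replacing the $i$-th column of $\bar U$ with $\bar\alpha$. (i) $\alpha\in\mathrm{cone}(u^1,\ldots,u^m)$ if and only if $$\det(\bar U)\det(\bar U_{\alpha i})\ge 0\quad\text{for all } i\in M.$$ Moreover, $\alpha\in\mathrm{ri}(\mathrm{cone}(u^1,\ldots,u^m))$ if and only if $$\det(\bar U)\det(\bar U_{\alpha i})> 0\quad\text{for all } i\in M.$$ (ii) For any choice of $u^1,\ldots,u^m$, $$v^\alpha\le \min_{i\in M}\frac{\sum_{j\in N}\beta_{ij}u_{ij}}{\sum_{j\in N}\beta_{ij}\alpha_j}.$$ Moreover, if $\det(\bar U)\det(\bar U_{\alpha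 i})\ge 0$ for all $i\in M$, then $$\frac{1}{\sum_{i\in M}\sum_{j\in M}\bar\alpha_j\left[\bar U^{-1}\right]_{ij}}\le v^\alpha,$$ where $[\bar U^{-1}]_{ij}$ is the $ij$-th element of $\bar U^{-1}$.
   Context: Let $(C,\mathcal{C})$ be a measurable space, $n\in\mathbb{N}$, $N=\{1,\ldots,n\}$, and let $\mu_1,\ldots,\mu_n$ be nonatomic finite (nonnegative) measures on $\mathcal{C}$. Let $\mathscr{P}$ be the set of all measurable partitions $(A_1,\ldots,A_n)$ of $C$: $A_i\in\mathcal{C}$, $\bigcup_{i\in N}A_i=C$, $A_i\cap A_j=\emptyset$ for $i\ne j$. $\Delta_{n-1}=\{x\in\mathbb{R}^n: x_i\ge 0 \text{ for all } i,\ \sum_i x_i=1\}$ is the $(n-1)$-dimensional simplex and $\mathrm{int}\,\Delta_{n-1}$ is the set of its points with all coordinates strictly positive. For $\alpha\in\mathrm{int}\,\Delta_{n-1}$, the $\alpha$-optimal partition value is $$v^\alpha=\sup\left\{\min_{i\in N}\frac{\mu_i(A_i)}{\alpha_i}:(A_1,\ldots,A_n)\in\mathscr{P}\right\}$$ (the supremum is attained). For $\beta=(\beta_1,\ldots,\beta_n)\in\Delta_{n-1}$, an efficient value vector (EVV) associated to (with respect to) $\beta$ is a vector $u^\beta=(\mu_1(A_1^\beta),\ldots,\mu_n(A_n^\beta))$, where $(A_1^\beta,\ldots,A_n^\beta)\in\mathscr{P}$ satisfies $$\sum_{i\in N}\beta_i\mu_i(A_i^\beta)=\sup\left\{\sum_{i\in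 N}\beta_i\mu_i(A_i):(A_1,\ldots,A_n)\in\mathscr{P}\right\}.$$ $\mathrm{cone}(u^1,\ldots,u^m)$ denotes the convex conical hull $\{\sum_i t_iu^i: t_i\ge 0\}$, and $\mathrm{ri}$ denotes relative interior.
   Formalization: The equivalences in (i) and the lower bound in (ii) are stated only for α in the linear span of u^1,…,u^m (automatic when m=n); without this they fail, e.g. n=2, m=1, equal Lebesgue measures on [0,1], α=(1/2,1/2), u^1=(1/3,2/3). *)

theory Defs
  imports "HOL-Analysis.Analysis"
begin

(* The players are the elements of a finite type 'n, so that vectors with one entry per player
   live in real ^ 'n. *)

definition nonatomic :: "'c measure \<Rightarrow> bool" where
  "nonatomic \<mu> \<longleftrightarrow>
     (\<forall>A\<in>sets \<mu>. 0 < emeasure \<mu> A \<longrightarrow>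
        (\<exists>B\<in>sets \<mu>. B \<subseteq> A \<and> 0 < emeasure \<mu> B \<and> emeasure \<mu> B < emeasure \<mu> A))"

(* Parts may be empty. Only the sigma-algebra of C matters, not the measure it carries. *)
definition partitions :: "'c measure \<Rightarrow> ('n \<Rightarrow> 'c set) set" where
  "partitions C = {A. range A \<subseteq> sets C \<and> (\<Union>i. A i) = space C \<and> disjoint_family A}"

definition std_simplex :: "(real ^ 'n) set" where
  "std_simplex = {x. (\<forall>i. 0 \<le> x $ i) \<and> (\<Sum>i\<in>UNIV. x $ i) = 1}"

(* The topological interior of the simplex in real ^ 'n is empty; this is the set of its points
   with positive coordinates. *)
definition int_simplex :: "(real ^ 'n) set" where
  "int_simplex = {x \<in> std_simplex. \<forall>i. 0 < x $ i}"

definition opt_value :: "'c measure \<Rightarrow> ('n::finite \<Rightarrow> 'c measure) \<Rightarrow> real ^ 'n \<Rightarrow> real" where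
  "opt_value C \<mu> \<alpha> = (SUP A\<in>partitions C. MIN i. measure (\<mu> i) (A i) / \<alpha> $ i)"

(* For finite measures the supremum is over a nonempty bounded set of reals. *)
definition is_EVV ::
    "'c measure \<Rightarrow> ('n::finite \<Rightarrow> 'c measure) \<Rightarrow> real ^ 'n \<Rightarrow> real ^ 'n \<Rightarrow> bool" where
  "is_EVV C \<mu> \<beta> u \<longleftrightarrow>
     (\<exists>A\<in>partitions C.
        u = (\<chi> i. measure (\<mu> i) (A i)) \<and>
        (\<Sum>i\<in>UNIV. \<beta> $ i * measure (\<mu> i) (A i)) =
          (SUP B\<in>partitions C. \<Sum>i\<in>UNIV. \<beta> $ i * measure (\<mu> i) (B i)))"

definition cone_of :: "('m::finite \<Rightarrow> real ^ 'n) \<Rightarrow> (real ^ 'n) set" where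
  "cone_of u = {\<Sum>i\<in>UNIV. t i *\<^sub>R u i |t. \<forall>i. 0 \<le> t i}"

definition matrix_of_columns :: "('m \<Rightarrow> real ^ 'n) \<Rightarrow> real ^ 'm ^ 'n" where
  "matrix_of_columns u = (\<chi> j i. u i $ j)"

(* An injection r from the index type 'm into the row indices selects the rows of a square
   submatrix. The index types are unordered, so the order in which the rows are listed
   is arbitrary.
   The selected rows determine the coefficients of a linear combination of the columns only for
   a vector known to lie in their span: for two players with the same measure and total mass 1,
   the single column u = (1/3, 2/3) and alpha = (1/2, 1/2), all determinants are positive, but
   alpha is not a multiple of u. Sign conditions on determinants of submatrices are therefore
   used under the premise that alpha is in the span, which is automatic for CARD('m) = CARD('n). *)
definition select_rows :: "('m \<Rightarrow> 'n) \<Rightarrow> real ^ 'm ^ 'n \<Rightarrow> real ^ 'm ^ 'm" where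
  "select_rows r U = (\<chi> k. U $ r k)"

definition select_entries :: "('m \<Rightarrow> 'n) \<Rightarrow> real ^ 'n \<Rightarrow> real ^ 'm" where
  "select_entries r x = (\<chi> k. x $ r k)"

definition replace_column :: "real ^ 'm ^ 'm \<Rightarrow> 'm \<Rightarrow> real ^ 'm \<Rightarrow> real ^ 'm ^ 'm" where
  "replace_column V i a = (\<chi> k j. if j = i then a $ k else V $ k $ j)"

end

(* Cramer's rule gives the coefficients of alpha in the basis u, and the relative interior of the
   cone is the image of the open orthant under an injective linear map.
   The upper bound compares the beta-weighted value of an arbitrary partition with that of an
   efficient one. For the lower bound, alpha divided by its total weight is a convex combination
   of value vectors. By Lyapunov's theorem it would be a value vector itself; since opt_value
   is a supremum, an approximate form suffices, and this is elementary. Cut the space into finitely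
   many pieces that are small for all measures, and on each piece follow one of the given partitions,
   drawn independently with the prescribed weights. The expected value vector is the convex
   combination, and its variance is bounded by the sum of the squared measures of the pieces, so some
   choice is close to it. *)

theory Submission
  imports Defs
begin

section \<open>Small pieces of nonatomic measures\<close>

text \<open>Nonatomicity splits a set of positive measure into two parts of positive measure, one of
  which has at most half of it. Iterated halving drops below any \<open>e\<close>.\<close>

lemma nonatomic_small_subset:
  assumes "finite_measure M" "nonatomic M" "A \<in> sets M" "0 < measure M A" "0 < (e::real)"
  shows "\<exists>B\<in>sets M. B \<subseteq> A \<and> 0 < measure M B \<and> measure M B < e"
proof -
  interpret finite_measure M by fact
  have half: "\<exists>B\<in>sets M. B \<subseteq> E \<and> 0 < measure M B \<and> measure M B \<le> measure M E / 2"
    if E: "E \<in> sets M" "0 < measure M E" for E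
  proof -
    obtain B where B: "B \<in> sets M" "B \<subseteq> E" "0 < measure M B" "measure M B < measure M E"
      using assms(2) E unfolding nonatomic_def emeasure_eq_measure by (auto simp: ennreal_less_iff)
    have D: "measure M (E - B) = measure M E - measure M B"
      using B E by (intro finite_measure_Diff) auto
    show ?thesis
    proof (cases "measure M B \<le> measure M E / 2")
      case True
      then show ?thesis using B by blast
    next
      case False
      then show ?thesis using B D E by (intro bexI[of _ "E - B"]) auto
    qed
  qed
  have "\<exists>B\<in>sets M. B \<subseteq> A \<and> 0 < measure M B \<and> measure M B \<le> measure M A / 2 ^ n" for n
  proof (induction n)
    case 0
    then show ?case using assms by auto
  next
    case (Suc n)
    then obtain B where B: "B\<in>sets M" "B \<subseteq> A" "0 < measure M B" "measure M B \<le> measure M A / 2 ^ n"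
      by blast
    obtain B' where "B'\<in>sets M" "B' \<subseteq> B" "0 < measure M B'" "measure M B' \<le> measure M B / 2"
      using half[OF B(1,3)] by blast
    moreover from this have "measure M B' \<le> measure M A / 2 ^ n / 2"
      using B(4) by argo
    ultimately show ?case using B by (intro bexI[of _ B']) auto
  qed
  moreover obtain n where "measure M A / 2 ^ n < e"
    using real_arch_pow_inv[of "e / measure M A" "1/2"] assms(4,5)
    by (auto simp: field_simps power_one_over)
  ultimately show ?thesis by (meson le_less_trans)
qed

text \<open>A set of pieces instead of an indexed family: when two partitions are intersected, equal
  (in particular empty) intersections collapse, and \<open>disjoint\<close> compares distinct pieces
  only.\<close>

definition fine_partition :: "'c measure \<Rightarrow> real \<Rightarrow> 'c set set \<Rightarrow> bool" where
  "fine_partition M e P \<longleftrightarrow>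
     finite P \<and> disjoint P \<and> P \<subseteq> sets M \<and> \<Union>P = space M \<and> (\<forall>A\<in>P. measure M A \<le> e)"

text \<open>An exhaustion argument: finite unions of small pieces approach their maximal measure
  along an increasing sequence. What the sequence misses is null, since otherwise a small subset of
  it could be added. Hence some finite stage leaves a remainder of measure at most \<open>e\<close>,
  which is the last piece.\<close>

lemma fine_partition_exists:
  assumes "finite_measure M" "nonatomic M" "0 < e"
  shows "\<exists>P. fine_partition M e P"
proof -
  interpret finite_measure M by fact
  \<comment> \<open>The sets that can be cut into finitely many measurable pieces of measure at most
    \<open>e\<close>; the goal amounts to \<open>space M \<in> D\<close>.\<close>
  define D where "D = {\<Union>P |P. finite P \<and> disjoint P \<and> P \<subseteq> sets M \<and> (\<forall>A\<in>P. measure M A \<le> e)}"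
  have D_sets: "D \<subseteq> sets M"
    unfolding D_def by (auto intro: sets.finite_Union)
  have D_empty: "{} \<in> D"
    unfolding D_def by (auto intro!: exI[of _ "{}"])
  have D_insert: "E \<union> B \<in> D"
    if "E \<in> D" "B \<in> sets M" "B \<inter> E = {}" "measure M B \<le> e" for E B
  proof -
    obtain P where P: "E = \<Union>P" "finite P" "disjoint P" "P \<subseteq> sets M" "\<forall>A\<in>P. measure M A \<le> e"
      using \<open>E \<in> D\<close> unfolding D_def by blast
    have "disjoint (insert B P)"
      using P(1,3) that(3) unfolding disjoint_def by blast
    then show ?thesis
      unfolding D_def using P that by (intro CollectI exI[of _ "insert B P"]) auto
  qed
  have D_Un: "E \<union> B \<in> D" if "E \<in> D" "B \<in> D" for E B
  proof -
    obtain P where P: "B = \<Union>P" "finite P" "P \<subseteq> sets M" "\<forall>A\<in>P. measure M A \<le> e"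
      using \<open>B \<in> D\<close> unfolding D_def by blast
    have "E \<union> \<Union>P \<in> D" using P(2-4)
    proof (induction P rule: finite_induct)
      case empty
      then show ?case using \<open>E \<in> D\<close> by simp
    next
      case (insert A P)
      then have IH: "E \<union> \<Union>P \<in> D" and A: "A \<in> sets M" "measure M A \<le> e" by auto
      then have mem: "E \<union> \<Union>P \<in> sets M" using D_sets by blast
      \<comment> \<open>Removing from the next piece what is already covered makes it disjoint from
        the rest and does not increase its measure.\<close>
      have "(E \<union> \<Union>P) \<union> (A - (E \<union> \<Union>P)) \<in> D"
      proof (rule D_insert[OF IH])
        show "measure M (A - (E \<union> \<Union>P)) \<le> e"
          using finite_measure_mono[of "A - (E \<union> \<Union>P)" A] A by auto
      qed (use mem A in auto)
      moreover have "(E \<union> \<Union>P) \<union> (A - (E \<union> \<Union>P)) = E \<union> \<Union>(insert A P)" by blast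
      ultimately show ?case by simp
    qed
    then show ?thesis using P by simp
  qed
  define s where "s = Sup (measure M ` D)"
  have bdd: "bdd_above (measure M ` D)"
    by (auto intro!: bdd_aboveI[of _ "measure M (space M)"] bounded_measure)
  have le_s: "measure M E \<le> s" if "E \<in> D" for E
    unfolding s_def using bdd that by (intro cSup_upper) auto
  have "\<exists>E\<in>D. s - 1 / real (Suc n) < measure M E" for n
    using less_cSup_iff[of "measure M ` D" "s - 1 / real (Suc n)"] bdd D_empty
    unfolding s_def by (auto simp: image_iff)
  then obtain E where E: "\<And>n. E n \<in> D" "\<And>n. s - 1 / real (Suc n) < measure M (E n)" by metis
  define F where "F n = (\<Union>k\<le>n. E k)" for n
  have FD: "F n \<in> D" for n
  proof (induction n)
    case 0
    then show ?case unfolding F_def using E by simp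
  next
    case (Suc n)
    have "F (Suc n) = F n \<union> E (Suc n)" unfolding F_def by (auto simp: atMost_Suc)
    then show ?case using D_Un[OF Suc E(1)] by simp
  qed
  have FS: "F n \<in> sets M" for n using FD D_sets by blast
  have EF: "measure M (E n) \<le> measure M (F n)" for n
    by (rule finite_measure_mono) (use FS in \<open>auto simp: F_def\<close>)
  have inc: "incseq F" unfolding F_def incseq_def by force
  define R where "R = space M - (\<Union>n. F n)"
  have RS: "R \<in> sets M" unfolding R_def using FS by auto
  have "measure M R = 0"
  proof (rule ccontr)
    assume "measure M R \<noteq> 0"
    then have "0 < measure M R" using measure_nonneg[of M R] by linarith
    then obtain B where B: "B \<in> sets M" "B \<subseteq> R" "0 < measure M B" "measure M B < e"
      using nonatomic_small_subset[OF assms(1,2) RS _ assms(3)] by blast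
    \<comment> \<open>\<open>F n\<close> is within \<open>1 / Suc n\<close> of the supremum
      \<open>s\<close>, so adding \<open>B\<close> to it would exceed \<open>s\<close>.\<close>
    obtain n where n: "1 / real (Suc n) < measure M B"
      using B(3) nat_approx_posE by blast
    have dj: "B \<inter> F n = {}" using B(2) unfolding R_def by blast
    have "measure M (F n \<union> B) = measure M (F n) + measure M B"
      using dj FS B by (intro finite_measure_Union) auto
    moreover have "F n \<union> B \<in> D" using D_insert[OF FD B(1) dj] B(4) by simp
    ultimately have "measure M (F n) + measure M B \<le> s" using le_s by metis
    then show False using E(2)[of n] EF[of n] n by linarith
  qed
  moreover have "measure M R = measure M (space M) - measure M (\<Union>n. F n)"
    unfolding R_def using FS by (intro finite_measure_compl) auto
  moreover have "(\<lambda>n. measure M (F n)) \<longlonglongrightarrow> measure M (\<Union>n. F n)"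
    using inc FS by (intro finite_Lim_measure_incseq) auto
  ultimately have "(\<lambda>n. measure M (F n)) \<longlonglongrightarrow> measure M (space M)" by simp
  \<comment> \<open>Continuity from below: from some stage on, the complement of \<open>F n\<close>
    is itself small enough to be one piece.\<close>
  then have "eventually (\<lambda>n. measure M (space M) - e < measure M (F n)) sequentially"
    using assms(3) by (intro order_tendstoD(1)) auto
  then obtain n where n: "measure M (space M) - e < measure M (F n)"
    by (auto simp: eventually_sequentially)
  have "F n \<union> (space M - F n) \<in> D"
    by (rule D_insert[OF FD]) (use FS n finite_measure_compl[of "F n"] in auto)
  moreover have "F n \<union> (space M - F n) = space M" using FS sets.sets_into_space by blast
  ultimately show ?thesis unfolding D_def fine_partition_def by force
qed

text \<open>Induction over the measures, intersecting with a fine partition for each new one. Pieces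
  only shrink, so the earlier bounds survive.\<close>

lemma common_fine_partition:
  fixes \<mu> :: "'n::finite \<Rightarrow> 'c measure"
  assumes "\<And>i. sets (\<mu> i) = sets C" "\<And>i. finite_measure (\<mu> i)" "\<And>i. nonatomic (\<mu> i)" "0 < e"
  shows "\<exists>P. \<forall>i. fine_partition (\<mu> i) e P"
proof -
  have sp: "space (\<mu> i) = space C" for i using assms(1) sets_eq_imp_space_eq by blast
  have "\<exists>P. finite P \<and> disjoint P \<and> P \<subseteq> sets C \<and> \<Union>P = space C \<and>
          (\<forall>i\<in>I. \<forall>A\<in>P. measure (\<mu> i) A \<le> e)" for I :: "'n set"
    using finite[of I]
  proof (induction I rule: finite_induct)
    case empty
    show ?case by (rule exI[of _ "{space C}"]) (auto simp: disjoint_def)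
  next
    case (insert k I)
    then obtain P where P: "finite P" "disjoint P" "P \<subseteq> sets C" "\<Union>P = space C"
      "\<forall>i\<in>I. \<forall>A\<in>P. measure (\<mu> i) A \<le> e" by blast
    obtain Q where "fine_partition (\<mu> k) e Q"
      using fine_partition_exists assms by blast
    then have Q: "finite Q" "disjoint Q" "Q \<subseteq> sets C" "\<Union>Q = space C"
      "\<forall>A\<in>Q. measure (\<mu> k) A \<le> e"
      by (auto simp: fine_partition_def assms sp)
    let ?R = "(\<lambda>(A, B). A \<inter> B) ` (P \<times> Q)"
    have le: "measure (\<mu> i) (A \<inter> B) \<le> measure (\<mu> i) A" "measure (\<mu> i) (A \<inter> B) \<le> measure (\<mu> i) B"
      if "A \<in> P" "B \<in> Q" for i A B
      using that P(3) Q(3) by (auto intro!: finite_measure.finite_measure_mono[OF assms(2)] simp: assms(1))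
    have "disjoint ?R"
      using P(2) Q(2) unfolding disjoint_def by blast
    moreover have "finite ?R" using P(1) Q(1) by blast
    moreover have "?R \<subseteq> sets C" using P(3) Q(3) by auto
    moreover have "\<Union>?R = space C"
    proof -
      have "\<Union>?R = \<Union>P \<inter> \<Union>Q" by blast
      then show ?thesis using P(4) Q(4) by simp
    qed
    moreover have "\<forall>i\<in>insert k I. \<forall>A\<in>?R. measure (\<mu> i) A \<le> e"
      using P(5) Q(5) by (auto intro: order_trans[OF le(1)] order_trans[OF le(2)])
    ultimately show ?case by blast
  qed
  from this[of UNIV] show ?thesis by (auto simp: fine_partition_def assms sp)
qed

section \<open>Approximate convexity of the set of value vectors\<close>

text \<open>The variance estimate for independent random choices with distribution \<open>t\<close>, derandomised:
  since the deviations \<open>d l\<close> average to zero, one of them makes no acute angle with the partial sum.\<close>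

lemma balanced_choice:
  fixes w :: "'l \<Rightarrow> 'm::finite \<Rightarrow> 'v::real_inner" and t :: "'m \<Rightarrow> real"
  assumes "finite L" "\<And>i. 0 \<le> t i" "sum t UNIV = 1"
    and bound: "\<And>l i. l \<in> L \<Longrightarrow> (norm (w l i - (\<Sum>k\<in>UNIV. t k *\<^sub>R w l k)))\<^sup>2 \<le> V l"
  shows "\<exists>c. (norm (\<Sum>l\<in>L. w l (c l) - (\<Sum>k\<in>UNIV. t k *\<^sub>R w l k)))\<^sup>2 \<le> sum V L"
  using assms(1) bound
proof (induction L rule: finite_induct)
  case empty
  then show ?case by simp
next
  case (insert l L)
  define d where "d l i = w l i - (\<Sum>k\<in>UNIV. t k *\<^sub>R w l k)" for l i
  obtain c where c: "(norm (\<Sum>l\<in>L. d l (c l)))\<^sup>2 \<le> sum V L"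
    using insert unfolding d_def by auto
  define s where "s = (\<Sum>l\<in>L. d l (c l))"
  have mean: "(\<Sum>i\<in>UNIV. t i *\<^sub>R d l i) = 0"
    by (simp add: d_def scaleR_right_diff_distrib sum_subtractf flip: scaleR_sum_left)
      (simp add: assms(3))
  have "\<exists>i. inner s (d l i) \<le> 0"
  proof (rule ccontr)
    assume "\<nexists>i. inner s (d l i) \<le> 0"
    then have pos: "0 < inner s (d l i)" for i by (simp add: not_le)
    have "(\<Sum>i\<in>UNIV. t i * inner s (d l i)) = inner s (\<Sum>i\<in>UNIV. t i *\<^sub>R d l i)"
      by (simp add: inner_sum_right)
    then have "(\<Sum>i\<in>UNIV. t i * inner s (d l i)) = 0" by (simp add: mean)
    \<comment> \<open>If all inner products were positive, every weight would vanish, contradicting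
      total weight 1.\<close>
    then have "\<forall>i. t i * inner s (d l i) = 0"
      using pos assms(2) by (subst (asm) sum_nonneg_eq_0_iff) (auto intro!: mult_nonneg_nonneg intro: less_imp_le)
    then have "t i = 0" for i using pos[of i] by (metis less_irrefl mult_eq_0_iff)
    then show False using assms(3) by simp
  qed
  then obtain i where i: "inner s (d l i) \<le> 0" by blast
  \<comment> \<open>The cross term is nonpositive, so the squared norms add without a mixed
    contribution.\<close>
  have "(norm (d l i + s))\<^sup>2 \<le> (norm (d l i))\<^sup>2 + (norm s)\<^sup>2"
    using i by (simp add: power2_norm_eq_inner inner_add_left inner_add_right inner_commute)
  also have "\<dots> \<le> V l + sum V L"
    using insert.prems[of l i] c unfolding d_def s_def by (intro add_mono) auto
  finally have "(norm (d l i + s))\<^sup>2 \<le> sum V (insert l L)" using insert.hyps by simp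
  moreover have "(\<Sum>x\<in>insert l L. d x ((c(l := i)) x)) = d l i + s"
    unfolding s_def using insert.hyps by (auto intro!: sum.cong)
  ultimately have "(norm (\<Sum>x\<in>insert l L. d x ((c(l := i)) x)))\<^sup>2 \<le> sum V (insert l L)"
    by (simp only:)
  then show ?case unfolding d_def by (rule exI[of _ "c(l := i)"])
qed

text \<open>An approximate form of Lyapunov's convexity theorem. On a piece \<open>E\<close> of
  measure at most \<open>d\<close> the deviation in coordinate \<open>j\<close> is at most
  \<open>measure (\<mu> j) E\<close>, so its square is at most \<open>d\<close> times that. Summed
  over coordinates and pieces, this gives \<open>d * S\<close>, where \<open>S\<close> is the total
  mass, however many pieces there are.\<close>

lemma approximately_convex_values:
  fixes \<mu> :: "'n::finite \<Rightarrow> 'c measure" and A :: "'m::finite \<Rightarrow> 'n \<Rightarrow> 'c set"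
  assumes sets: "\<And>j. sets (\<mu> j) = sets C" and fin: "\<And>j. finite_measure (\<mu> j)"
    and na: "\<And>j. nonatomic (\<mu> j)"
    and A: "\<And>i. A i \<in> partitions C"
    and t: "\<And>i. 0 \<le> t i" "sum t UNIV = 1" and "0 < e"
  shows "\<exists>B\<in>partitions C.
    \<forall>j. \<bar>measure (\<mu> j) (B j) - (\<Sum>i\<in>UNIV. t i * measure (\<mu> j) (A i j))\<bar> \<le> e"
proof -
  have sp: "space (\<mu> j) = space C" for j using sets sets_eq_imp_space_eq by blast
  have A_sets: "A i j \<in> sets C" and A_space: "(\<Union>j. A i j) = space C" for i j
    using A[of i] by (auto simp: partitions_def)
  have A_disj: "j = k" if "x \<in> A i j" "x \<in> A i k" for i j k x
    using A[of i] that unfolding partitions_def disjoint_family_on_def by blast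
  define S where "S = (\<Sum>j\<in>UNIV. measure (\<mu> j) (space C))"
  have "0 \<le> S" unfolding S_def by (simp add: sum_nonneg)
  \<comment> \<open>Chosen so that \<open>d * S\<close> is at most the square of \<open>e\<close>;
    the \<open>+ 1\<close> keeps the denominator positive when all measures vanish.\<close>
  define d where "d = e\<^sup>2 / (S + 1)"
  have "0 < d" unfolding d_def using \<open>0 \<le> S\<close> \<open>0 < e\<close> by simp
  have dS: "d * S \<le> e\<^sup>2" unfolding d_def using \<open>0 \<le> S\<close> by (simp add: field_simps)
  obtain P where fine: "\<And>j. fine_partition (\<mu> j) d P"
    using common_fine_partition[of \<mu> C d, OF sets fin na \<open>0 < d\<close>] by blast
  \<comment> \<open>These properties of \<open>P\<close> are the same for every player, so an
    arbitrary one is used.\<close>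
  have P: "finite P" "disjoint P" "P \<subseteq> sets C" "\<Union>P = space C"
    using fine[of undefined] by (simp_all add: fine_partition_def sets sp)
  have P_le: "measure (\<mu> j) E \<le> d" if "E \<in> P" for E j
    using fine[of j] that by (simp add: fine_partition_def)
  have decomp: "measure (\<mu> j) (\<Union>E\<in>P. E \<inter> A (c E) j) = (\<Sum>E\<in>P. measure (\<mu> j) (E \<inter> A (c E) j))" for c j
    using P(1-3) A_sets
    by (intro finite_measure.finite_measure_finite_Union[OF fin])
      (auto simp: disjoint_family_on_def disjoint_def sets)
  \<comment> \<open>The contribution of the piece \<open>E\<close> to the value vector when
    \<open>E\<close> is divided according to \<open>A i\<close>.\<close>
  define w :: "'c set \<Rightarrow> 'm \<Rightarrow> real ^ 'n" where "w E i = (\<chi> j. measure (\<mu> j) (E \<inter> A i j))" for E i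
  have "(norm (w E i - (\<Sum>k\<in>UNIV. t k *\<^sub>R w E k)))\<^sup>2 \<le> (\<Sum>j\<in>UNIV. d * measure (\<mu> j) E)"
    if "E \<in> P" for E i
  proof -
    have "((w E i - (\<Sum>k\<in>UNIV. t k *\<^sub>R w E k)) $ j)\<^sup>2 \<le> d * measure (\<mu> j) E" for j
    proof -
      let ?m = "measure (\<mu> j) E" and ?s = "\<Sum>k\<in>UNIV. t k * measure (\<mu> j) (E \<inter> A k j)"
      have le: "measure (\<mu> j) (E \<inter> A k j) \<le> ?m" for k
        using that P(3) A_sets
        by (intro finite_measure.finite_measure_mono[OF fin]) (auto simp: sets)
      have "?s \<le> (\<Sum>k\<in>UNIV. t k * ?m)"
        by (intro sum_mono mult_left_mono le t)
      also have "\<dots> = ?m" using t(2) by (simp flip: sum_distrib_right)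
      finally have "?s \<le> ?m" .
      moreover have "0 \<le> ?s" by (intro sum_nonneg mult_nonneg_nonneg t) simp
      \<comment> \<open>Both numbers lie between 0 and \<open>?m\<close>.\<close>
      ultimately have "\<bar>measure (\<mu> j) (E \<inter> A i j) - ?s\<bar> \<le> ?m"
        using le[of i] measure_nonneg[of "\<mu> j" "E \<inter> A i j"] by linarith
      then have "(measure (\<mu> j) (E \<inter> A i j) - ?s)\<^sup>2 \<le> ?m\<^sup>2"
        by (simp add: abs_le_square_iff[symmetric])
      also have "\<dots> \<le> d * ?m"
        unfolding power2_eq_square using P_le[OF that] by (intro mult_right_mono) auto
      finally show ?thesis by (simp add: w_def sum_component)
    qed
    then show ?thesis
      unfolding power2_norm_eq_inner inner_vec_def by (intro sum_mono) (simp add: power2_eq_square)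
  qed
  then have "\<exists>c. (norm (\<Sum>E\<in>P. w E (c E) - (\<Sum>k\<in>UNIV. t k *\<^sub>R w E k)))\<^sup>2
      \<le> (\<Sum>E\<in>P. \<Sum>j\<in>UNIV. d * measure (\<mu> j) E)"
    by (intro balanced_choice P(1) t)
  then obtain c where c: "(norm (\<Sum>E\<in>P. w E (c E) - (\<Sum>k\<in>UNIV. t k *\<^sub>R w E k)))\<^sup>2
      \<le> (\<Sum>E\<in>P. \<Sum>j\<in>UNIV. d * measure (\<mu> j) E)" by blast
  \<comment> \<open>The glued partition: each piece \<open>E\<close> is divided as in the partition
    \<open>A (c E)\<close> chosen for it.\<close>
  define B where "B j = (\<Union>E\<in>P. E \<inter> A (c E) j)" for j
  have "(\<Sum>E\<in>P. measure (\<mu> j) E) = measure (\<mu> j) (space C)" for j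
  proof -
    have "measure (\<mu> j) (\<Union>E\<in>P. E) = (\<Sum>E\<in>P. measure (\<mu> j) E)"
      using P(1-3) by (intro finite_measure.finite_measure_finite_Union[OF fin])
        (auto simp: disjoint_family_on_def disjoint_def sets)
    then show ?thesis using P(4) by simp
  qed
  then have "(\<Sum>E\<in>P. \<Sum>j\<in>UNIV. d * measure (\<mu> j) E) = d * S"
    by (subst sum.swap) (simp add: S_def flip: sum_distrib_left)
  with c dS have "(norm (\<Sum>E\<in>P. w E (c E) - (\<Sum>k\<in>UNIV. t k *\<^sub>R w E k)))\<^sup>2 \<le> e\<^sup>2" by linarith
  then have err: "norm (\<Sum>E\<in>P. w E (c E) - (\<Sum>k\<in>UNIV. t k *\<^sub>R w E k)) \<le> e"
    using \<open>0 < e\<close> by (simp add: power2_le_iff_abs_le)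
  have "\<bar>measure (\<mu> j) (B j) - (\<Sum>i\<in>UNIV. t i * measure (\<mu> j) (A i j))\<bar> \<le> e" for j
  proof -
    have "A i j = (\<Union>E\<in>P. E \<inter> A i j)" for i
      using A_space[of i] P(4) by blast
    then have "measure (\<mu> j) (A i j) = (\<Sum>E\<in>P. measure (\<mu> j) (E \<inter> A i j))" for i
      using decomp[of j "\<lambda>_. i"] by simp
    \<comment> \<open>The target splits over the pieces just as the value of \<open>B\<close> does,
      so their difference is a coordinate of the sum bounded in \<open>err\<close>.\<close>
    then have "(\<Sum>i\<in>UNIV. t i * measure (\<mu> j) (A i j)) =
        (\<Sum>E\<in>P. \<Sum>i\<in>UNIV. t i * measure (\<mu> j) (E \<inter> A i j))"
      by (subst sum.swap) (simp add: sum_distrib_left)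
    then have "measure (\<mu> j) (B j) - (\<Sum>i\<in>UNIV. t i * measure (\<mu> j) (A i j)) =
        (\<Sum>E\<in>P. w E (c E) - (\<Sum>k\<in>UNIV. t k *\<^sub>R w E k)) $ j"
      unfolding B_def decomp by (simp add: w_def sum_component sum_subtractf)
    then show ?thesis by (simp only:) (rule order_trans[OF component_le_norm_cart err])
  qed
  moreover have "B \<in> partitions C"
  proof -
    have "range B \<subseteq> sets C"
      unfolding B_def using P(1,3) A_sets by (auto intro!: sets.finite_UN)
    moreover have "(\<Union>j. B j) = space C"
    proof -
      have "(\<Union>j. B j) = (\<Union>E\<in>P. E \<inter> (\<Union>j. A (c E) j))" unfolding B_def by blast
      also have "\<dots> = space C" using P(4) unfolding A_space by blast
      finally show ?thesis .
    qed
    \<comment> \<open>A common point lies in only one piece, and inside that piece both parts come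
      from the same partition.\<close>
    moreover have "B j \<inter> B k = {}" if "j \<noteq> k" for j k
    proof (rule ccontr)
      assume "B j \<inter> B k \<noteq> {}"
      then obtain x E F where EF: "E \<in> P" "F \<in> P" "x \<in> E" "x \<in> A (c E) j" "x \<in> F" "x \<in> A (c F) k"
        unfolding B_def by blast
      then have "E = F" using disjointD[OF P(2)] by blast
      then show False using A_disj[of x "c E" j k] EF that by simp
    qed
    ultimately show ?thesis by (simp add: partitions_def disjoint_family_on_def)
  qed
  ultimately show ?thesis by blast
qed

section \<open>Upper and lower bounds for the optimal value\<close>

lemma bdd_above_min_ratio:
  fixes \<mu> :: "'n::finite \<Rightarrow> 'c measure"
  assumes "\<And>i. finite_measure (\<mu> i)" "\<And>i. 0 < \<alpha> $ i"
  shows "bdd_above ((\<lambda>A. MIN i. measure (\<mu> i) (A i) / \<alpha> $ i) ` partitions C)"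
proof (rule bdd_aboveI2)
  fix A
  \<comment> \<open>Any single player bounds the minimum.\<close>
  let ?k = "undefined :: 'n"
  have "(MIN i. measure (\<mu> i) (A i) / \<alpha> $ i) \<le> measure (\<mu> ?k) (A ?k) / \<alpha> $ ?k"
    by (intro Min_le) auto
  also have "\<dots> \<le> measure (\<mu> ?k) (space (\<mu> ?k)) / \<alpha> $ ?k"
    using assms by (intro divide_right_mono finite_measure.bounded_measure) (auto intro: less_imp_le)
  finally show "(MIN i. measure (\<mu> i) (A i) / \<alpha> $ i) \<le> measure (\<mu> ?k) (space (\<mu> ?k)) / \<alpha> $ ?k" .
qed

text \<open>If \<open>v\<close> is the least ratio of a partition \<open>B\<close>, then player
  \<open>j\<close> receives at least \<open>v * \<alpha> $ j\<close>. Weighting by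
  \<open>\<beta>\<close> and summing, \<open>v\<close> times the denominator is at most the weighted
  value of \<open>B\<close>, hence at most the efficient one.\<close>

lemma opt_value_le_EVV_ratio:
  fixes \<mu> :: "'n::finite \<Rightarrow> 'c measure"
  assumes fin: "\<And>i. finite_measure (\<mu> i)"
    and \<alpha>: "\<alpha> \<in> int_simplex" and \<beta>: "\<beta> \<in> std_simplex" and u: "is_EVV C \<mu> \<beta> u"
  shows "opt_value C \<mu> \<alpha> \<le> (\<Sum>j\<in>UNIV. \<beta> $ j * u $ j) / (\<Sum>j\<in>UNIV. \<beta> $ j * \<alpha> $ j)"
proof -
  have \<alpha>_pos: "0 < \<alpha> $ j" and \<beta>_nonneg: "0 \<le> \<beta> $ j" for j
    using \<alpha> \<beta> by (auto simp: int_simplex_def std_simplex_def)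
  let ?b = "\<lambda>B. \<Sum>j\<in>UNIV. \<beta> $ j * measure (\<mu> j) (B j)"
  obtain A where A: "A \<in> partitions C" "u = (\<chi> i. measure (\<mu> i) (A i))"
    "?b A = (SUP B\<in>partitions C. ?b B)"
    using u unfolding is_EVV_def by blast
  have bdd: "bdd_above (?b ` partitions C)"
    by (rule bdd_aboveI2[of _ _ "\<Sum>j\<in>UNIV. \<beta> $ j * measure (\<mu> j) (space (\<mu> j))"])
      (intro sum_mono mult_left_mono \<beta>_nonneg finite_measure.bounded_measure fin)
  \<comment> \<open>One nonzero weight makes the denominator positive, because all entries of
    \<open>\<alpha>\<close> are positive.\<close>
  obtain k where "\<beta> $ k \<noteq> 0"
    using \<beta> by (force simp: std_simplex_def intro: ccontr)
  then have pos: "0 < (\<Sum>j\<in>UNIV. \<beta> $ j * \<alpha> $ j)"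
    using \<alpha>_pos \<beta>_nonneg
    by (intro sum_pos2[of _ k]) (auto simp: less_le intro!: mult_nonneg_nonneg)
  show ?thesis
    unfolding opt_value_def
  proof (rule cSUP_least)
    fix B :: "'n \<Rightarrow> 'c set" assume B: "B \<in> partitions C"
    let ?v = "MIN i::'n. measure (\<mu> i) (B i) / \<alpha> $ i"
    have "?v \<le> measure (\<mu> j) (B j) / \<alpha> $ j" for j by (intro Min_le) auto
    then have "?v * \<alpha> $ j \<le> measure (\<mu> j) (B j)" for j
      using pos_le_divide_eq[OF \<alpha>_pos] by blast
    then have "(\<Sum>j\<in>UNIV. \<beta> $ j * (?v * \<alpha> $ j)) \<le> ?b B"
      by (intro sum_mono mult_left_mono \<beta>_nonneg)
    also have "\<dots> \<le> ?b A" unfolding A(3) using bdd B by (rule cSUP_upper2) simp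
    also have "\<dots> = (\<Sum>j\<in>UNIV. \<beta> $ j * u $ j)" by (simp add: A(2))
    finally have "?v * (\<Sum>j\<in>UNIV. \<beta> $ j * \<alpha> $ j) \<le> (\<Sum>j\<in>UNIV. \<beta> $ j * u $ j)"
      unfolding sum_distrib_left mult.left_commute[of ?v] .
    then show "?v \<le> (\<Sum>j\<in>UNIV. \<beta> $ j * u $ j) / (\<Sum>j\<in>UNIV. \<beta> $ j * \<alpha> $ j)"
      using pos by (simp only: pos_le_divide_eq)
  qed (use A in blast)
qed

text \<open>Dividing \<open>\<alpha>\<close> by the total weight makes it a convex combination of
  value vectors. A partition with nearly these values gives every player a ratio close to the
  inverse of the total weight.\<close>

lemma inverse_weight_le_opt_value:
  fixes \<mu> :: "'n::finite \<Rightarrow> 'c measure" and t :: "'m::finite \<Rightarrow> real"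
  assumes sets: "\<And>j. sets (\<mu> j) = sets C" and fin: "\<And>j. finite_measure (\<mu> j)"
    and na: "\<And>j. nonatomic (\<mu> j)"
    and \<alpha>: "\<alpha> \<in> int_simplex" and u: "\<And>i. is_EVV C \<mu> (\<beta> i) (u i)"
    and t: "\<And>i. 0 \<le> t i" and \<alpha>_eq: "\<alpha> = (\<Sum>i\<in>UNIV. t i *\<^sub>R u i)"
  shows "1 / sum t UNIV \<le> opt_value C \<mu> \<alpha>"
proof (rule field_le_epsilon)
  fix e :: real assume "0 < e"
  have \<alpha>_pos: "0 < \<alpha> $ j" for j using \<alpha> by (auto simp: int_simplex_def)
  obtain A where A: "\<And>i. A i \<in> partitions C" "\<And>i. u i = (\<chi> j. measure (\<mu> j) (A i j))"
    using u unfolding is_EVV_def by metis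
  let ?T = "sum t UNIV"
  have "?T \<noteq> 0"
  proof
    assume "?T = 0"
    then have "\<alpha> = 0" unfolding \<alpha>_eq using t by (simp add: sum_nonneg_eq_0_iff)
    then show False using \<alpha>_pos by simp
  qed
  moreover have "0 \<le> ?T" by (intro sum_nonneg t)
  ultimately have T: "0 < ?T" by simp
  \<comment> \<open>An error of \<open>e * a\<close> in a player's value becomes at most
    \<open>e\<close> after division by that player's entry of \<open>\<alpha>\<close>.\<close>
  define a where "a = (MIN j. \<alpha> $ j)"
  have a: "0 < a" "\<And>j. a \<le> \<alpha> $ j" unfolding a_def using \<alpha>_pos by auto
  have "\<exists>B\<in>partitions C. \<forall>j.
      \<bar>measure (\<mu> j) (B j) - (\<Sum>i\<in>UNIV. t i / ?T * measure (\<mu> j) (A i j))\<bar> \<le> e * a"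
    using T t a \<open>0 < e\<close>
    by (intro approximately_convex_values sets fin na A) (auto simp flip: sum_divide_distrib)
  then obtain B where B: "B \<in> partitions C"
    "\<And>j. \<bar>measure (\<mu> j) (B j) - (\<Sum>i\<in>UNIV. t i / ?T * measure (\<mu> j) (A i j))\<bar> \<le> e * a"
    by blast
  have "1 / ?T - e \<le> measure (\<mu> j) (B j) / \<alpha> $ j" for j
  proof -
    have "(\<Sum>i\<in>UNIV. t i / ?T * measure (\<mu> j) (A i j)) = \<alpha> $ j / ?T"
      by (subst \<alpha>_eq) (simp add: A(2) sum_component sum_divide_distrib)
    moreover have "e * a \<le> e * \<alpha> $ j" using a \<open>0 < e\<close> by simp
    ultimately have "\<alpha> $ j / ?T - e * \<alpha> $ j \<le> measure (\<mu> j) (B j)" using B(2)[of j] by linarith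
    then have "(1 / ?T - e) * \<alpha> $ j \<le> measure (\<mu> j) (B j)" by (simp add: left_diff_distrib)
    then show ?thesis using \<alpha>_pos[of j] by (simp only: pos_le_divide_eq)
  qed
  then have "1 / ?T - e \<le> (MIN j. measure (\<mu> j) (B j) / \<alpha> $ j)" by simp
  also have "\<dots> \<le> opt_value C \<mu> \<alpha>"
    unfolding opt_value_def using bdd_above_min_ratio[OF fin \<alpha>_pos] B(1) by (rule cSUP_upper2) simp
  finally show "1 / ?T \<le> opt_value C \<mu> \<alpha> + e" by simp
qed

section \<open>Cones as linear images of the orthant, and inverse matrices\<close>

lemma matrix_of_columns_mult: "matrix_of_columns u *v x = (\<Sum>i\<in>UNIV. x $ i *\<^sub>R u i)"
  by (simp add: vec_eq_iff matrix_of_columns_def matrix_vector_mult_def sum_component mult.commute)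

lemma select_rows_mult: "select_rows r U *v x = select_entries r (U *v x)"
  by (simp add: vec_eq_iff select_rows_def select_entries_def matrix_vector_mult_def)

text \<open>With the cone written as a linear image, membership and relative interior can be read
  off from coordinates once the map is injective.\<close>

lemma cone_of_eq_image: "cone_of u = (*v) (matrix_of_columns u) ` {x. \<forall>i. 0 \<le> x $ i}"
proof -
  have "\<exists>x. (\<Sum>i\<in>UNIV. t i *\<^sub>R u i) = matrix_of_columns u *v x \<and> (\<forall>i. 0 \<le> x $ i)"
    if "\<forall>i. 0 \<le> t i" for t
    by (rule exI[of _ "\<chi> i. t i"]) (use that in \<open>simp add: matrix_of_columns_mult\<close>)
  then show ?thesis unfolding cone_of_def
    by (auto simp: matrix_of_columns_mult image_iff) blast+
qed

lemma rel_interior_orthant: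
  "rel_interior {x :: real ^ 'n. \<forall>i. 0 \<le> x $ i} = {x. \<forall>i. 0 < x $ i}"
proof -
  have "interior {x :: real ^ 'n. \<forall>i. 0 \<le> x $ i} = {x. \<forall>i. 0 < x $ i}" (is "interior ?S = ?T")
  proof
    have "interior ?S \<subseteq> interior {x. x $ i \<ge> 0}" for i by (rule interior_mono) auto
    then show "interior ?S \<subseteq> ?T" by auto
    have "?T = (\<Inter>i. {x. x $ i > 0})" by auto
    then have "open ?T"
      by (simp only:) (intro open_INT ballI finite open_halfspace_component_gt_cart)
    then show "?T \<subseteq> interior ?S" by (intro interior_maximal) (auto intro: less_imp_le)
  qed
  \<comment> \<open>The all-ones vector shows that the interior is nonempty, and then it coincides
    with the relative interior.\<close>
  moreover have "(1 :: real ^ 'n) \<in> {x. \<forall>i. 0 < x $ i}" by simp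
  ultimately show ?thesis by (metis empty_iff rel_interior_nonempty_interior)
qed

lemma matrix_inv_eqI:
  fixes V :: "real ^ 'm ^ 'm"
  assumes "det V \<noteq> 0" "V *v x = b"
  shows "matrix_inv V *v b = x"
proof -
  \<comment> \<open>\<open>matrix_inv\<close> is a Hilbert choice; a nonzero determinant ensures
    that there is an inverse to choose.\<close>
  have "matrix_inv V ** V = mat 1"
    using assms(1) unfolding matrix_inv_def invertible_det_nz[symmetric] invertible_def
    by (rule someI2_ex) simp
  then show ?thesis using assms(2) by (metis matrix_vector_mul_assoc matrix_vector_mul_lid)
qed

section \<open>Cramer's rule applied to the cone and to the value bounds\<close>

theorem theorem1:
  fixes C :: "'c measure"
    and \<mu> :: "'n::finite \<Rightarrow> 'c measure"
    and \<alpha> :: "real ^ 'n"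
    and \<beta> u :: "'m::finite \<Rightarrow> real ^ 'n"
    and U :: "real ^ 'm ^ 'n"
    and r :: "'m \<Rightarrow> 'n"
    and Ubar :: "real ^ 'm ^ 'm"
    and abar :: "real ^ 'm"
    and Ualpha :: "'m \<Rightarrow> real ^ 'm ^ 'm"
  assumes "\<And>i. sets (\<mu> i) = sets C"
    and "\<And>i. finite_measure (\<mu> i)"
    and "\<And>i. nonatomic (\<mu> i)"
    and "\<alpha> \<in> int_simplex"
    and "CARD('m) \<le> CARD('n)"
    and "\<And>i. \<beta> i \<in> std_simplex"
    and "\<And>i. is_EVV C \<mu> (\<beta> i) (u i)"
    and "inj u" and "independent (range u)"
    and "U = matrix_of_columns u"
    and "inj r"
    and "Ubar = select_rows r U"
    and "det Ubar \<noteq> 0"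
    and "abar = select_entries r \<alpha>"
    and "\<And>i. Ualpha i = replace_column Ubar i abar"
  shows "(\<alpha> \<in> span (range u) \<longrightarrow>
        (\<alpha> \<in> cone_of u \<longleftrightarrow> (\<forall>i. det Ubar * det (Ualpha i) \<ge> 0)) \<and>
        (\<alpha> \<in> rel_interior (cone_of u) \<longleftrightarrow> (\<forall>i. det Ubar * det (Ualpha i) > 0))) \<and>
      opt_value C \<mu> \<alpha> \<le>
        (MIN i. (\<Sum>j\<in>UNIV. \<beta> i $ j * u i $ j) / (\<Sum>j\<in>UNIV. \<beta> i $ j * \<alpha> $ j)) \<and>
      (\<alpha> \<in> span (range u) \<longrightarrow> (\<forall>i. det Ubar * det (Ualpha i) \<ge> 0) \<longrightarrow>
        1 / (\<Sum>i\<in>UNIV. \<Sum>j\<in>UNIV. abar $ j * matrix_inv Ubar $ i $ j) \<le> opt_value C \<mu> \<alpha>)"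
proof -
  note U = \<open>U = matrix_of_columns u\<close> and Ubar = \<open>Ubar = select_rows r U\<close>
    and det = \<open>det Ubar \<noteq> 0\<close>
  \<comment> \<open>The Cramer solution of the selected square system, the only candidate for the
    coefficients of \<open>\<alpha>\<close>.\<close>
  define x :: "real ^ 'm" where "x = (\<chi> i. det (Ualpha i) / det Ubar)"
  have cramer_x: "Ubar *v y = abar \<longleftrightarrow> y = x" for y
    unfolding cramer[OF det] x_def assms(15) replace_column_def by simp
  \<comment> \<open>The selected rows alone determine the argument, because \<open>Ubar\<close> is
    invertible.\<close>
  have inj: "inj ((*v) U)"
  proof (rule injI)
    fix y z assume "U *v y = U *v z"
    then have "Ubar *v y = Ubar *v z" unfolding Ubar select_rows_mult by simp
    then show "y = z" using matrix_inv_eqI[OF det] by metis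
  qed
  \<comment> \<open>Here the span premise enters: some \<open>y\<close> solves the full system,
    hence also the selected rows, so it must be \<open>x\<close>.\<close>
  have \<alpha>_eq: "\<alpha> = U *v x" if span: "\<alpha> \<in> span (range u)"
  proof -
    have "span (range u) \<subseteq> range ((*v) U)"
    proof (rule span_minimal)
      have "u i = U *v axis i 1" for i
        by (simp add: U matrix_of_columns_def matrix_vector_mult_basis column_def vec_eq_iff)
      then show "range u \<subseteq> range ((*v) U)" by auto
      show "subspace (range ((*v) U))"
        by (intro linear_subspace_image) auto
    qed
    with span obtain y where y: "\<alpha> = U *v y" by blast
    then have "Ubar *v y = abar" by (simp add: Ubar select_rows_mult assms(14))
    then show ?thesis using y cramer_x by simp
  qed
  \<comment> \<open>The product of two reals has the sign of their quotient when the divisor is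
    nonzero.\<close>
  have sign: "det Ubar * det (Ualpha i) \<ge> 0 \<longleftrightarrow> 0 \<le> x $ i"
    "det Ubar * det (Ualpha i) > 0 \<longleftrightarrow> 0 < x $ i" for i
    using det by (auto simp: x_def zero_le_mult_iff zero_less_mult_iff zero_le_divide_iff zero_less_divide_iff)
  have "\<alpha> \<in> cone_of u \<longleftrightarrow> (\<forall>i. det Ubar * det (Ualpha i) \<ge> 0)" if "\<alpha> \<in> span (range u)"
    unfolding sign cone_of_eq_image U[symmetric] \<alpha>_eq[OF that] inj_image_mem_iff[OF inj] by simp
  \<comment> \<open>Relative interior commutes with an injective linear map, so the condition
    becomes strict positivity of \<open>x\<close>.\<close>
  moreover have "\<alpha> \<in> rel_interior (cone_of u) \<longleftrightarrow> (\<forall>i. det Ubar * det (Ualpha i) > 0)"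
    if "\<alpha> \<in> span (range u)"
    unfolding sign cone_of_eq_image U[symmetric] \<alpha>_eq[OF that]
      rel_interior_injective_linear_image[OF matrix_vector_mul_bounded_linear inj]
      rel_interior_orthant inj_image_mem_iff[OF inj] by simp
  moreover have "opt_value C \<mu> \<alpha> \<le>
      (MIN i. (\<Sum>j\<in>UNIV. \<beta> i $ j * u i $ j) / (\<Sum>j\<in>UNIV. \<beta> i $ j * \<alpha> $ j))"
    using opt_value_le_EVV_ratio[OF assms(2,4,6,7)] by simp
  moreover have "1 / (\<Sum>i\<in>UNIV. \<Sum>j\<in>UNIV. abar $ j * matrix_inv Ubar $ i $ j) \<le> opt_value C \<mu> \<alpha>"
    if "\<alpha> \<in> span (range u)" "\<forall>i. det Ubar * det (Ualpha i) \<ge> 0"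
  proof -
    \<comment> \<open>This identifies the double sum in the bound as the total weight of the
      coefficients \<open>x\<close>.\<close>
    have "matrix_inv Ubar *v abar = x" by (intro matrix_inv_eqI det) (simp add: cramer_x)
    then have "x $ i = (\<Sum>j\<in>UNIV. abar $ j * matrix_inv Ubar $ i $ j)" for i
      by (auto simp: matrix_vector_mult_def mult.commute)
    moreover have "1 / (\<Sum>i\<in>UNIV. x $ i) \<le> opt_value C \<mu> \<alpha>"
      using that \<alpha>_eq by (intro inverse_weight_le_opt_value[OF assms(1-4,7)])
        (auto simp: sign U matrix_of_columns_mult)
    ultimately show ?thesis by simp
  qed
  ultimately show ?thesis by blast
qed

end
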